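(* Let $A\in S^{n\times n}$, $x_0,a,b_1,\ldots,b_m\in\mathbb{R}^n$ and $\gamma,\alpha,\beta_1,\ldots,\beta_m\in\mathbb{R}$, with $\{x\in\mathbb{R}^n:\|x-x_0\|^2\le\alpha,\ b_i^Tx\le\beta_i,\ i=1,\ldots,m\}\ne\emptyset$. Suppose that ${\rm dim}\,{\rm Ker}(A-\lambda_{\min}(A)I_n)\ge s+1$, where $s={\rm dim}\,{\rm span}\{b_1,\ldots,b_m\}$. Then the following statements are equivalent: (1) For every $x\in\mathbb{R}^n$: if $\|x-x_0\|^2-\alpha\le 0$ and $b_i^Tx-\beta_i\le 0$, $i=1,\ldots,m$, then $x^TAx+a^Tx+\gamma\ge 0$. (2) For every $\epsilon>0$ there exist $\lambda_i\ge 0$, $i=0,1,\ldots,m$, such that for all $x\in\mathbb{R}^n$, $$(x^TAx+a^Tx+\gamma)+\lambda_0(\|x-x_0\|^2-\alpha)+\sum_{i=1}^m\lambda_i(b_i^Tx-\beta_i)+\epsilon\ge 0.$$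
   Context: $S^{n\times n}$ is the space of real symmetric $n\times n$ matrices, $\lambda_{\min}(A)$ is the smallest eigenvalue of $A$, ${\rm Ker}(M)=\{d: Md=0\}$, and $\|\cdot\|$ is the Euclidean norm. *)

theory Defs
  imports "HOL-Analysis.Analysis"
begin

definition real_eigenvalues :: "real ^ 'n ^ 'n \<Rightarrow> real set" where
  "real_eigenvalues A = {l. \<exists>v. v \<noteq> 0 \<and> A *v v = l *\<^sub>R v}"

(* Min is meaningful only on finite nonempty sets. The set of eigenvalues of a square matrix is
   always finite, and it is nonempty when A is symmetric. *)
definition lambda_min :: "real ^ 'n ^ 'n \<Rightarrow> real" where
  "lambda_min A = Min (real_eigenvalues A)"

definition Ker :: "real ^ 'n ^ 'm \<Rightarrow> (real ^ 'n) set" where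
  "Ker M = {d. M *v d = 0}"

end

theory Submission
  imports Defs
begin

text \<open>
  Put \<open>\<nu> = min (lambda_min A) 0\<close> and let \<open>f\<close>, \<open>g\<^sub>0\<close> be the objective and the ball constraint. The
  function \<open>h = f - \<nu> g\<^sub>0\<close> is convex. If \<open>\<nu> < 0\<close>, the dimension hypothesis yields a nonzero
  \<open>d \<in> Ker (A - \<nu> I)\<close> orthogonal to all \<open>b i\<close>; along \<open>d\<close> the function \<open>h\<close> is affine and the linear
  constraints are constant, so from a feasible point one can move without increasing \<open>h\<close> to the
  boundary of the ball, where \<open>h = f \<ge> 0\<close>. Hence \<open>h + \<epsilon> > 0\<close> on the feasible set, and convex duality
  gives multipliers. Duality without a Slater point is available because the relevant sublevel sets
  are compact, so that strict separation applies in the plane, one constraint at a time.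
\<close>

subsection \<open>Convex duality with compact sublevel sets\<close>

lemma convex_sublevel:
  fixes f :: "'a::real_vector \<Rightarrow> real"
  assumes "convex_on K f"
  shows "convex {x\<in>K. f x \<le> c}"
proof (rule convexI)
  fix x y and s t :: real
  assume xy: "x \<in> {x\<in>K. f x \<le> c}" "y \<in> {x\<in>K. f x \<le> c}" and st: "0 \<le> s" "0 \<le> t" "s + t = 1"
  have "s *\<^sub>R x + t *\<^sub>R y \<in> K"
    using assms xy st by (auto simp: convex_on_def intro: convexD)
  moreover have "f (s *\<^sub>R x + t *\<^sub>R y) \<le> s * f x + t * f y"
    using assms xy st by (simp add: convex_on_def)
  moreover have "s * f x + t * f y \<le> c"
    using xy st by (intro convex_bound_le) auto
  ultimately show "s *\<^sub>R x + t *\<^sub>R y \<in> {x\<in>K. f x \<le> c}"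
    by simp
qed

lemma convex_on_nonneg_combination:
  fixes g :: "'i \<Rightarrow> 'a::real_vector \<Rightarrow> real"
  assumes "finite I" "convex_on K H"
    and "\<And>i. i \<in> I \<Longrightarrow> convex_on K (g i)" "\<And>i. i \<in> I \<Longrightarrow> l i \<ge> 0"
  shows "convex_on K (\<lambda>x. H x + (\<Sum>i\<in>I. l i * g i x))"
  using assms
proof (induction I rule: finite_induct)
  case (insert j I)
  have "convex_on K (\<lambda>x. (H x + (\<Sum>i\<in>I. l i * g i x)) + l j * g j x)"
    using insert by (intro convex_on_add[OF insert.IH] convex_on_cmul) auto
  then show ?case
    using insert.hyps by (simp add: algebra_simps)
qed simp

text \<open>Strict separation in the plane: compact sublevel sets of \<open>g\<close> make the set
  of dominated value pairs closed, so the origin can be separated from it with a positive gap. That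
  gap excludes a vanishing coefficient of \<open>H\<close>, which is the usual task of a Slater
  point.\<close>

lemma convex_multiplier_single:
  fixes H g :: "'a::euclidean_space \<Rightarrow> real"
  assumes H: "convex_on K H" "continuous_on K H"
    and g: "convex_on K g" "continuous_on K g"
    and comp: "\<And>v. compact {x\<in>K. g x \<le> v}"
    and feas: "x0 \<in> K" "g x0 \<le> 0"
    and pos: "\<And>x. x \<in> K \<Longrightarrow> g x \<le> 0 \<Longrightarrow> H x > 0"
  obtains l where "l \<ge> 0" "\<And>x. x \<in> K \<Longrightarrow> H x + l * g x > 0"
proof -
  \<comment> \<open>The upward closure of the image of \<open>K\<close> under \<open>(H, g)\<close>.
    The assumption \<open>pos\<close> says exactly that the origin lies outside it.\<close>
  define C where "C = {(u, v). \<exists>x\<in>K. H x \<le> u \<and> g x \<le> v}"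
  have "convex K"
    using H(1) by (simp add: convex_on_def)
  have "convex C"
  proof (rule convexI)
    fix z w :: "real \<times> real" and s t :: real
    assume zw: "z \<in> C" "w \<in> C" and st: "0 \<le> s" "0 \<le> t" "s + t = 1"
    obtain x where x: "x \<in> K" "H x \<le> fst z" "g x \<le> snd z"
      using zw(1) by (auto simp: C_def)
    obtain y where y: "y \<in> K" "H y \<le> fst w" "g y \<le> snd w"
      using zw(2) by (auto simp: C_def)
    have "s *\<^sub>R x + t *\<^sub>R y \<in> K"
      using \<open>convex K\<close> x y st by (simp add: convexD)
    moreover have "H (s *\<^sub>R x + t *\<^sub>R y) \<le> s * H x + t * H y"
      using H(1) x y st by (simp add: convex_on_def)
    moreover have "s * H x + t * H y \<le> s * fst z + t * fst w"
      using x y st by (intro add_mono mult_left_mono) auto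
    moreover have "g (s *\<^sub>R x + t *\<^sub>R y) \<le> s * g x + t * g y"
      using g(1) x y st by (simp add: convex_on_def)
    moreover have "s * g x + t * g y \<le> s * snd z + t * snd w"
      using x y st by (intro add_mono mult_left_mono) auto
    ultimately show "s *\<^sub>R z + t *\<^sub>R w \<in> C"
      unfolding C_def case_prod_beta mem_Collect_eq fst_add snd_add fst_scaleR snd_scaleR
        real_scaleR_def by (meson order_trans)
  qed
  moreover have "closed C"
    unfolding closed_sequential_limits
  proof (intro allI impI, elim conjE)
    fix z :: "nat \<Rightarrow> real \<times> real" and w
    assume zC: "\<forall>n. z n \<in> C" and lim: "z \<longlonglongrightarrow> w"
    have lim1: "(\<lambda>n. fst (z n)) \<longlonglongrightarrow> fst w" and lim2: "(\<lambda>n. snd (z n)) \<longlonglongrightarrow> snd w"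
      using lim by (auto intro: tendsto_intros)
    have "\<forall>n. \<exists>x\<in>K. H x \<le> fst (z n) \<and> g x \<le> snd (z n)"
      using zC by (auto simp: C_def case_prod_beta)
    then obtain x where x: "\<And>n. x n \<in> K" "\<And>n. H (x n) \<le> fst (z n)" "\<And>n. g (x n) \<le> snd (z n)"
      by metis
    \<comment> \<open>A convergent second coordinate is bounded, so all witnesses \<open>x n\<close>
      lie in a single compact sublevel set of \<open>g\<close> and a subsequence converges inside
      \<open>K\<close>.\<close>
    obtain B where B: "\<And>n. snd (z n) \<le> B"
      using convergent_imp_Bseq[OF convergentI[OF lim2]] by (auto simp: Bseq_def abs_le_iff)
    have "\<forall>n. x n \<in> {x\<in>K. g x \<le> B}"
      using x B order_trans by blast
    then obtain y r where y: "y \<in> {x\<in>K. g x \<le> B}" and r: "strict_mono r" "(x \<circ> r) \<longlonglongrightarrow> y"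
      using comp[of B] unfolding compact_def by blast
    have cont: "(\<lambda>n. F (x (r n))) \<longlonglongrightarrow> F y" if "continuous_on K F" for F :: "'a \<Rightarrow> real"
      using continuous_on_tendsto_compose[OF that, of "x \<circ> r" y sequentially] r(2) x(1) y
      by (simp add: o_def)
    have "H y \<le> fst w"
      using cont[OF H(2)] LIMSEQ_subseq_LIMSEQ[OF lim1 r(1)] x(2)
      by (intro LIMSEQ_le[of "\<lambda>n. H (x (r n))" _ "\<lambda>n. fst (z (r n))"]) (auto simp: o_def)
    moreover have "g y \<le> snd w"
      using cont[OF g(2)] LIMSEQ_subseq_LIMSEQ[OF lim2 r(1)] x(3)
      by (intro LIMSEQ_le[of "\<lambda>n. g (x (r n))" _ "\<lambda>n. snd (z (r n))"]) (auto simp: o_def)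
    ultimately show "w \<in> C"
      using y by (auto simp: C_def case_prod_beta)
  qed
  moreover have "(0, 0) \<notin> C"
    using pos by (force simp: C_def)
  ultimately obtain a c where ac: "inner a (0, 0) < c" "\<And>z. z \<in> C \<Longrightarrow> c < inner a z"
    using separating_hyperplane_closed_point[of C "(0, 0)"] by metis
  obtain p q where a: "a = (p, q)"
    by (cases a)
  have c: "c > 0"
    using ac(1) by (simp add: a)
  have sep: "p * u + q * v > 0" if "x \<in> K" "H x \<le> u" "g x \<le> v" for x u v
  proof -
    have "(u, v) \<in> C"
      using that by (auto simp: C_def)
    then show ?thesis
      using ac(2)[of "(u, v)"] c by (simp add: a)
  qed
  define N where "N = p * H x0 + q * g x0"
  have N: "N > 0"
    unfolding N_def by (rule sep[OF feas(1) order_refl order_refl])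
  \<comment> \<open>\<open>C\<close> is closed under raising either coordinate. With a negative
    coefficient, raising by \<open>T\<close> would bring the functional down from \<open>N\<close>
    to exactly 0, against \<open>sep\<close>.\<close>
  have "p \<ge> 0"
  proof (rule ccontr)
    assume p: "\<not> p \<ge> 0"
    define T where "T = - N / p"
    have "T \<ge> 0"
      using p N by (simp add: T_def divide_nonneg_neg divide_nonpos_neg)
    have "p * T = - N"
      using p by (simp add: T_def)
    moreover have "p * (H x0 + T) + q * g x0 > 0"
      by (rule sep[OF feas(1)]) (use \<open>T \<ge> 0\<close> in auto)
    ultimately show False
      by (simp add: N_def algebra_simps)
  qed
  have "q \<ge> 0"
  proof (rule ccontr)
    assume q: "\<not> q \<ge> 0"
    define T where "T = - N / q"
    have "T \<ge> 0"
      using q N by (simp add: T_def divide_nonneg_neg divide_nonpos_neg)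
    have "q * T = - N"
      using q by (simp add: T_def)
    moreover have "p * H x0 + q * (g x0 + T) > 0"
      by (rule sep[OF feas(1)]) (use \<open>T \<ge> 0\<close> in auto)
    ultimately show False
      by (simp add: N_def algebra_simps)
  qed
  \<comment> \<open>As \<open>g x0 \<le> 0\<close>, the pair \<open>(H x0, 0)\<close> belongs to
    \<open>C\<close>; strict positivity there rules out \<open>p = 0\<close>.\<close>
  have "p * H x0 + q * 0 > 0"
    by (rule sep[OF feas(1)]) (use feas in auto)
  then have p: "p > 0"
    using \<open>p \<ge> 0\<close> by (cases "p = 0") auto
  show thesis
  proof
    show "q / p \<ge> 0"
      using p \<open>q \<ge> 0\<close> by simp
    show "H x + q / p * g x > 0" if "x \<in> K" for x
      using sep[OF that order_refl order_refl] p by (simp add: field_simps)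
  qed
qed

text \<open>Induction on the constraints with varying domain: one constraint is hidden in the
  domain, the others get multipliers there, and the single-constraint lemma then recovers the hidden
  one on all of \<open>K\<close>.\<close>

lemma convex_multipliers_compact:
  fixes H :: "'a::euclidean_space \<Rightarrow> real" and g :: "'i \<Rightarrow> 'a \<Rightarrow> real"
  assumes "finite I" "compact K" "convex_on K H" "continuous_on K H"
    and "\<And>i. i \<in> I \<Longrightarrow> convex_on K (g i)" "\<And>i. i \<in> I \<Longrightarrow> continuous_on K (g i)"
    and "x0 \<in> K" "\<And>i. i \<in> I \<Longrightarrow> g i x0 \<le> 0"
    and "\<And>x. x \<in> K \<Longrightarrow> (\<And>i. i \<in> I \<Longrightarrow> g i x \<le> 0) \<Longrightarrow> H x > 0"
  shows "\<exists>l. (\<forall>i\<in>I. l i \<ge> 0) \<and> (\<forall>x\<in>K. H x + (\<Sum>i\<in>I. l i * g i x) > 0)"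
  using assms
proof (induction I arbitrary: K rule: finite_induct)
  case empty
  then show ?case by auto
next
  case (insert j I)
  define K' where "K' = {x\<in>K. g j x \<le> 0}"
  have comp: "compact {x\<in>K. g j x \<le> v}" for v
  proof -
    have "closed {x\<in>K. g j x \<le> v}"
      using insert.prems compact_imp_closed
      by (intro continuous_on_closed_Collect_le) auto
    moreover have "{x\<in>K. g j x \<le> v} = K \<inter> {x\<in>K. g j x \<le> v}"
      by auto
    ultimately show ?thesis
      using compact_Int_closed insert.prems(1) by metis
  qed
  have "convex K'"
    unfolding K'_def using insert.prems(4) by (intro convex_sublevel) simp
  have sub: "K' \<subseteq> K"
    by (auto simp: K'_def)
  have "\<exists>l. (\<forall>i\<in>I. l i \<ge> 0) \<and> (\<forall>x\<in>K'. H x + (\<Sum>i\<in>I. l i * g i x) > 0)"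
  proof (rule insert.IH)
    show "compact K'"
      using comp[of 0] by (simp add: K'_def)
    show "convex_on K' H" "\<And>i. i \<in> I \<Longrightarrow> convex_on K' (g i)"
      using insert.prems(2,4) by (auto intro: convex_on_subset[OF _ sub \<open>convex K'\<close>])
    show "continuous_on K' H" "\<And>i. i \<in> I \<Longrightarrow> continuous_on K' (g i)"
      using insert.prems(3,5) by (auto intro: continuous_on_subset[OF _ sub])
    show "x0 \<in> K'" "\<And>i. i \<in> I \<Longrightarrow> g i x0 \<le> 0"
      using insert.prems(6,7) by (auto simp: K'_def)
    show "H x > 0" if "x \<in> K'" "\<And>i. i \<in> I \<Longrightarrow> g i x \<le> 0" for x
      using insert.prems(8)[of x] that by (auto simp: K'_def)
  qed
  then obtain l where l: "\<And>i. i \<in> I \<Longrightarrow> l i \<ge> 0"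
    "\<And>x. x \<in> K' \<Longrightarrow> H x + (\<Sum>i\<in>I. l i * g i x) > 0"
    by auto
  have "convex_on K (\<lambda>x. H x + (\<Sum>i\<in>I. l i * g i x))"
    using insert.prems(2,4) l(1) insert.hyps(1)
    by (intro convex_on_nonneg_combination) auto
  moreover have "continuous_on K (\<lambda>x. H x + (\<Sum>i\<in>I. l i * g i x))"
    using insert.prems by (intro continuous_intros) auto
  ultimately obtain c where c: "c \<ge> 0"
      "\<And>x. x \<in> K \<Longrightarrow> (H x + (\<Sum>i\<in>I. l i * g i x)) + c * g j x > 0"
    using convex_multiplier_single[of K "\<lambda>x. H x + (\<Sum>i\<in>I. l i * g i x)" "g j" x0]
      insert.prems comp l(2) by (auto simp: K'_def)
  have eq: "(\<Sum>i\<in>I. (l(j := c)) i * g i x) = (\<Sum>i\<in>I. l i * g i x)" for x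
    using insert.hyps by (intro sum.cong) auto
  have "(\<forall>i\<in>insert j I. (l(j := c)) i \<ge> 0) \<and>
      (\<forall>x\<in>K. H x + (\<Sum>i\<in>insert j I. (l(j := c)) i * g i x) > 0)"
    unfolding sum.insert[OF insert.hyps] eq using l(1) c by (simp add: algebra_simps)
  then show ?case
    by (rule exI[of _ "l(j := c)"])
qed

subsection \<open>Quadratic forms and the smallest eigenvalue\<close>

lemma symmetric_inner:
  fixes A :: "real ^ 'n ^ 'n"
  assumes "transpose A = A"
  shows "inner x (A *v y) = inner (A *v x) y"
  using dot_lmul_matrix[of x A y] transpose_matrix_vector[of A x] assms by simp

text \<open>The convexity gap of a quadratic function is exactly \<open>t * (1 - t)\<close> times
  its quadratic form at \<open>x - y\<close>.\<close>

lemma convex_on_quadratic: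
  fixes M :: "real ^ 'n ^ 'n"
  assumes "\<And>x. inner x (M *v x) \<ge> 0"
  shows "convex_on UNIV (\<lambda>x. inner x (M *v x) + inner c x + k)"
proof (rule convex_onI)
  fix t :: real and x y :: "real ^ 'n"
  assume t: "0 < t" "t < 1"
  let ?q = "\<lambda>x. inner x (M *v x) + inner c x + k"
  have "?q ((1 - t) *\<^sub>R x + t *\<^sub>R y)
      = (1 - t) * ?q x + t * ?q y - t * (1 - t) * inner (x - y) (M *v (x - y))"
    by (simp add: matrix_vector_right_distrib matrix_vector_mult_diff_distrib
        matrix_vector_mult_scaleR inner_simps algebra_simps)
  moreover have "t * (1 - t) * inner (x - y) (M *v (x - y)) \<ge> 0"
    using t assms by simp
  ultimately show "?q ((1 - t) *\<^sub>R x + t *\<^sub>R y) \<le> (1 - t) * ?q x + t * ?q y"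
    by linarith
qed auto

text \<open>Otherwise a small move from \<open>v\<close> along \<open>- (M *v v)\<close> would make
  the form negative. This turns a minimizer of the Rayleigh quotient into an eigenvector.\<close>

lemma psd_null_vector:
  fixes M :: "real ^ 'n ^ 'n"
  assumes sym: "transpose M = M" and psd: "\<And>x. inner x (M *v x) \<ge> 0"
    and null: "inner v (M *v v) = 0"
  shows "M *v v = 0"
proof (rule ccontr)
  assume "M *v v \<noteq> 0"
  define w where "w = M *v v"
  define k where "k = inner w (M *v w)"
  have N: "inner w w > 0"
    using \<open>M *v v \<noteq> 0\<close> by (simp add: w_def)
  have k: "k \<ge> 0"
    using psd by (simp add: k_def)
  \<comment> \<open>Small enough that the second-order term \<open>t * k\<close> stays below
    \<open>2 * inner w w\<close>; the 1 keeps the denominator positive when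
    \<open>k = 0\<close>.\<close>
  define t where "t = inner w w / (k + 1)"
  have t: "t > 0"
    using N k by (simp add: t_def)
  have "inner (v - t *\<^sub>R w) (M *v (v - t *\<^sub>R w)) = - 2 * t * inner w w + t * t * k"
    using null symmetric_inner[OF sym, of v w]
    by (simp add: matrix_vector_mult_diff_distrib matrix_vector_mult_scaleR inner_simps
        w_def[symmetric] k_def[symmetric] inner_commute algebra_simps)
  also have "\<dots> = t * (t * k - 2 * inner w w)"
    by (simp add: algebra_simps)
  also have "t * k \<le> t * (k + 1)"
    using t by simp
  also have "t * (k + 1) = inner w w"
    using k by (simp add: t_def)
  finally have "inner (v - t *\<^sub>R w) (M *v (v - t *\<^sub>R w)) \<le> t * (inner w w - 2 * inner w w)"
    using t by simp
  also have "\<dots> < 0"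
    using t N by (simp add: mult_pos_neg)
  finally show False
    using psd[of "v - t *\<^sub>R w"] by linarith
qed

text \<open>Eigenvectors of distinct eigenvalues are orthogonal, hence independent. Finiteness is
  what gives \<open>Min\<close> in \<open>lambda_min\<close> its meaning as a lower bound.\<close>

lemma finite_real_eigenvalues:
  fixes A :: "real ^ 'n ^ 'n"
  assumes sym: "transpose A = A"
  shows "finite (real_eigenvalues A)"
proof -
  obtain e where e: "\<And>l. l \<in> real_eigenvalues A \<Longrightarrow> e l \<noteq> 0 \<and> A *v e l = l *\<^sub>R e l"
    using that[of "\<lambda>l. SOME v. v \<noteq> 0 \<and> A *v v = l *\<^sub>R v"] someI_ex
    unfolding real_eigenvalues_def by (metis (mono_tags, lifting) mem_Collect_eq)
  have orth: "inner (e l) (e l') = 0"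
    if "l \<in> real_eigenvalues A" "l' \<in> real_eigenvalues A" "l \<noteq> l'" for l l'
  proof -
    have "l' * inner (e l) (e l') = l * inner (e l) (e l')"
      using symmetric_inner[OF sym, of "e l" "e l'"] e that by simp
    then show ?thesis
      using that by simp
  qed
  have "inj_on e (real_eigenvalues A)"
    by (rule inj_onI) (metis e inner_eq_zero_iff orth)
  moreover have "finite (e ` real_eigenvalues A)"
  proof (rule independent_imp_finite, rule pairwise_orthogonal_independent)
    show "pairwise orthogonal (e ` real_eigenvalues A)"
      using orth by (auto simp: pairwise_def orthogonal_def)
    show "0 \<notin> e ` real_eigenvalues A"
      using e by auto
  qed
  ultimately show ?thesis
    using finite_image_iff by blast
qed

text \<open>The minimum \<open>r\<close> of the form on the unit sphere is attained and is itself an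
  eigenvalue, so \<open>lambda_min A\<close> is at most \<open>r\<close>.\<close>

lemma lambda_min_le_rayleigh:
  fixes A :: "real ^ 'n ^ 'n"
  assumes sym: "transpose A = A"
  shows "lambda_min A * inner x x \<le> inner x (A *v x)"
proof -
  have "compact (sphere (0::real^'n) 1)" "sphere (0::real^'n) 1 \<noteq> {}"
    by auto
  moreover have "continuous_on (sphere 0 1) (\<lambda>x. inner x (A *v x))"
    by (intro continuous_intros)
  ultimately obtain v where v: "norm v = 1"
    and min: "\<And>y. norm y = 1 \<Longrightarrow> inner v (A *v v) \<le> inner y (A *v y)"
    using continuous_attains_inf[of "sphere (0::real^'n) 1" "\<lambda>x. inner x (A *v x)"] by auto
  define r where "r = inner v (A *v v)"
  have ray: "r * inner x x \<le> inner x (A *v x)" for x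
  proof (cases "x = 0")
    case False
    have "r \<le> inner ((1 / norm x) *\<^sub>R x) (A *v ((1 / norm x) *\<^sub>R x))"
      unfolding r_def using False by (intro min) simp
    also have "\<dots> = inner x (A *v x) / inner x x"
      by (simp add: matrix_vector_mult_scaleR power2_eq_square flip: power2_norm_eq_inner)
    finally show ?thesis
      using False by (simp add: field_simps)
  qed simp
  have "(A - r *\<^sub>R mat 1) *v v = 0"
  proof (rule psd_null_vector)
    show "transpose (A - r *\<^sub>R mat 1) = A - r *\<^sub>R mat 1"
      using sym by (auto simp: transpose_def mat_def vec_eq_iff)
    show "inner x ((A - r *\<^sub>R mat 1) *v x) \<ge> 0" for x
      using ray[of x] by (simp add: matrix_vector_mult_diff_rdistrib inner_simps
          flip: scaleR_matrix_vector_assoc)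
    show "inner v ((A - r *\<^sub>R mat 1) *v v) = 0"
      using v by (simp add: matrix_vector_mult_diff_rdistrib inner_simps r_def norm_eq_1
          flip: scaleR_matrix_vector_assoc)
  qed
  then have "A *v v = r *\<^sub>R v"
    by (simp add: matrix_vector_mult_diff_rdistrib flip: scaleR_matrix_vector_assoc)
  moreover have "v \<noteq> 0"
    using v by auto
  ultimately have "r \<in> real_eigenvalues A"
    by (auto simp: real_eigenvalues_def)
  then have "lambda_min A \<le> r"
    unfolding lambda_min_def using finite_real_eigenvalues[OF sym] by (rule Min_le[rotated])
  then have "lambda_min A * inner x x \<le> r * inner x x"
    by (intro mult_right_mono) auto
  then show ?thesis
    using ray[of x] by linarith
qed

subsection \<open>Descent to the boundary of the ball\<close>

text \<open>Dimension count: the orthogonal complement \<open>P\<close> of \<open>S\<close> has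
  codimension \<open>dim S\<close>, so it meets the larger subspace \<open>W\<close>
  nontrivially.\<close>

lemma subspace_orthogonal_vector:
  fixes W S :: "'a::euclidean_space set"
  assumes "subspace W" "dim W > dim S"
  obtains d where "d \<in> W" "d \<noteq> 0" "\<And>x. x \<in> S \<Longrightarrow> inner x d = 0"
proof -
  define P where "P = {y. \<forall>x\<in>span S. orthogonal x y}"
  have P: "subspace P"
    unfolding P_def by (rule subspace_orthogonal_to_vectors)
  have "dim P + dim S = DIM('a)"
    using dim_subspace_orthogonal_to_vectors[of "span S" UNIV] by (simp add: P_def)
  moreover have "dim {x + y |x y. x \<in> W \<and> y \<in> P} + dim (W \<inter> P) = dim W + dim P"
    using dim_sums_Int[OF assms(1) P] .
  moreover have "dim {x + y |x y. x \<in> W \<and> y \<in> P} \<le> DIM('a)"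
    by (rule dim_subset_UNIV)
  ultimately have "dim (W \<inter> P) > 0"
    using assms(2) by linarith
  then have "\<not> W \<inter> P \<subseteq> {0}"
    by (metis dim_eq_0 less_irrefl)
  then obtain d where "d \<in> W \<inter> P" "d \<noteq> 0"
    by blast
  then show thesis
    using that by (auto simp: P_def orthogonal_def span_base)
qed

lemma ray_meets_sphere:
  fixes d :: "'a::real_inner"
  assumes "d \<noteq> 0" "(norm x)\<^sup>2 \<le> \<alpha>"
  obtains t where "t \<ge> 0" "(norm (x + t *\<^sub>R d))\<^sup>2 = \<alpha>"
proof -
  have "\<alpha> \<ge> 0"
    using assms(2) order_trans zero_le_power2 by blast
  \<comment> \<open>Long enough that the triangle inequality puts the endpoint on or outside the
    sphere; the intermediate value theorem then finds the crossing.\<close>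
  define T where "T = (sqrt \<alpha> + norm x) / norm d"
  have "T \<ge> 0"
    using \<open>\<alpha> \<ge> 0\<close> by (simp add: T_def)
  have "norm (T *\<^sub>R d) = sqrt \<alpha> + norm x"
    using \<open>\<alpha> \<ge> 0\<close> assms(1) by (simp add: T_def)
  then have "sqrt \<alpha> \<le> norm (x + T *\<^sub>R d)"
    using norm_triangle_ineq4[of "x + T *\<^sub>R d" x] by simp
  then have "\<alpha> \<le> (norm (x + T *\<^sub>R d))\<^sup>2"
    by (simp add: sqrt_le_D)
  then have "\<exists>t\<ge>0. t \<le> T \<and> (norm (x + t *\<^sub>R d))\<^sup>2 = \<alpha>"
    using assms(2) \<open>T \<ge> 0\<close> by (intro IVT') (auto intro!: continuous_intros)
  then show thesis
    using that by blast
qed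

section \<open>Nonnegativity on the feasible set versus multipliers up to
  \<open>\<epsilon>\<close>\<close>

theorem corollary4p4:
  fixes A :: "real ^ 'n ^ 'n"
    and x0 a :: "real ^ 'n"
    and m s :: nat
    and b :: "nat \<Rightarrow> real ^ 'n"
    and \<gamma> \<alpha> :: real
    and \<beta> :: "nat \<Rightarrow> real"
  assumes "transpose A = A"
    and "{x. (norm (x - x0))\<^sup>2 \<le> \<alpha> \<and> (\<forall>i\<in>{1..m}. b i \<bullet> x \<le> \<beta> i)} \<noteq> {}"
    and "s = dim (span (b ` {1..m}))"
    and "dim (Ker (A - lambda_min A *\<^sub>R mat 1)) \<ge> s + 1"
  shows
    "(\<forall>x. (norm (x - x0))\<^sup>2 - \<alpha> \<le> 0 \<and> (\<forall>i\<in>{1..m}. b i \<bullet> x - \<beta> i \<le> 0)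
        \<longrightarrow> x \<bullet> (A *v x) + a \<bullet> x + \<gamma> \<ge> 0)
     \<longleftrightarrow>
     (\<forall>\<epsilon>>0. \<exists>l :: nat \<Rightarrow> real. (\<forall>i\<in>{0..m}. l i \<ge> 0) \<and>
        (\<forall>x. (x \<bullet> (A *v x) + a \<bullet> x + \<gamma>) + l 0 * ((norm (x - x0))\<^sup>2 - \<alpha>)
              + (\<Sum>i=1..m. l i * (b i \<bullet> x - \<beta> i)) + \<epsilon> \<ge> 0))"
proof -
  define f where "f x = x \<bullet> (A *v x) + a \<bullet> x + \<gamma>" for x
  define g0 where "g0 x = (norm (x - x0))\<^sup>2 - \<alpha>" for x
  define g where "g i x = b i \<bullet> x - \<beta> i" for i x
  define \<mu> where "\<mu> = lambda_min A"
  \<comment> \<open>\<open>\<nu> \<le> \<mu>\<close> makes \<open>A - \<nu> I\<close> positive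
    semidefinite, hence \<open>h\<close> convex; \<open>\<nu> \<le> 0\<close> keeps the final ball
    multiplier nonnegative and gives \<open>h = f\<close> when \<open>\<mu> \<ge> 0\<close>.\<close>
  define \<nu> where "\<nu> = min \<mu> 0"
  define h where "h x = f x - \<nu> * g0 x" for x
  obtain z where z: "g0 z \<le> 0" "\<And>i. i \<in> {1..m} \<Longrightarrow> g i z \<le> 0"
    using assms(2) by (auto simp: g0_def g_def)
  have \<nu>: "\<nu> \<le> 0"
    by (simp add: \<nu>_def)
  have cont: "continuous_on S h" "continuous_on S g0" "continuous_on S (g i)" for S i
    unfolding h_def f_def g0_def g_def by (auto intro!: continuous_intros)
  have conv_h: "convex_on UNIV h"
  proof -
    have "h = (\<lambda>x. x \<bullet> ((A - \<nu> *\<^sub>R mat 1) *v x) + (a + (2 * \<nu>) *\<^sub>R x0) \<bullet> x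
              + (\<gamma> - \<nu> * (x0 \<bullet> x0) + \<nu> * \<alpha>))"
      by (auto simp: h_def f_def g0_def fun_eq_iff power2_norm_eq_inner inner_simps
          matrix_vector_mult_diff_rdistrib inner_commute algebra_simps
          simp flip: scaleR_matrix_vector_assoc)
    moreover have "x \<bullet> ((A - \<nu> *\<^sub>R mat 1) *v x) \<ge> 0" for x
    proof -
      have "\<nu> * (x \<bullet> x) \<le> \<mu> * (x \<bullet> x)"
        by (intro mult_right_mono) (auto simp: \<nu>_def)
      then show ?thesis
        using lambda_min_le_rayleigh[OF assms(1), of x]
        by (simp add: matrix_vector_mult_diff_rdistrib inner_simps \<mu>_def
            flip: scaleR_matrix_vector_assoc)
    qed
    ultimately show ?thesis
      by (simp only: convex_on_quadratic)
  qed
  have conv_g0: "convex_on UNIV g0"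
  proof -
    have "g0 = (\<lambda>x. x \<bullet> (mat 1 *v x) + (- 2 *\<^sub>R x0) \<bullet> x + (x0 \<bullet> x0 - \<alpha>))"
      by (auto simp: g0_def fun_eq_iff power2_norm_eq_inner inner_simps inner_commute)
    then show ?thesis
      by (simp only:) (rule convex_on_quadratic, simp)
  qed
  have conv_g: "convex_on UNIV (g i)" for i
  proof -
    have "g i = (\<lambda>x. x \<bullet> (0 *v x) + b i \<bullet> x + (- \<beta> i))"
      by (auto simp: g_def fun_eq_iff)
    then show ?thesis
      by (simp only:) (rule convex_on_quadratic, simp)
  qed
  have comp: "compact {x. g0 x \<le> v}" for v
  proof -
    have "norm (x - x0) \<le> sqrt (\<alpha> + v)" if "g0 x \<le> v" for x
      using that by (intro real_le_rsqrt) (simp add: g0_def)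
    then have "{x. g0 x \<le> v} \<subseteq> cball x0 (sqrt (\<alpha> + v))"
      by (auto simp: dist_norm norm_minus_commute)
    then have "bounded {x. g0 x \<le> v}"
      using bounded_cball bounded_subset by blast
    moreover have "closed {x. g0 x \<le> v}"
      by (intro closed_Collect_le cont continuous_on_const)
    ultimately show ?thesis
      by (simp add: compact_eq_bounded_closed)
  qed

  have h_nonneg: "h x \<ge> 0"
    if f: "\<And>x. g0 x \<le> 0 \<Longrightarrow> (\<And>i. i \<in> {1..m} \<Longrightarrow> g i x \<le> 0) \<Longrightarrow> f x \<ge> 0"
      and x: "g0 x \<le> 0" "\<And>i. i \<in> {1..m} \<Longrightarrow> g i x \<le> 0" for x
  proof (cases "\<mu> \<ge> 0")
    case True
    then show ?thesis
      using f x by (simp add: h_def \<nu>_def)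
  next
    case False
    then have \<nu>\<mu>: "\<nu> = \<mu>"
      by (simp add: \<nu>_def)
    let ?W = "Ker (A - \<mu> *\<^sub>R mat 1)"
    have "subspace ?W"
      by (auto simp: subspace_def Ker_def matrix_vector_right_distrib matrix_vector_mult_scaleR)
    moreover have "dim ?W > dim (b ` {1..m})"
      using assms(3,4) by (simp add: \<mu>_def)
    ultimately obtain e where e: "e \<in> ?W" "e \<noteq> 0" "\<And>y. y \<in> b ` {1..m} \<Longrightarrow> y \<bullet> e = 0"
      using subspace_orthogonal_vector by blast
    \<comment> \<open>The coefficient of the linear part of \<open>h\<close>. Since
      \<open>A - \<mu> I\<close> kills the direction, \<open>h\<close> is affine along it with slope
      \<open>c \<bullet> d\<close>; the sign of \<open>d\<close> is chosen to make this slope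
      nonpositive.\<close>
    define c where "c = a + (2 * \<mu>) *\<^sub>R x0"
    define d where "d = (if c \<bullet> e \<le> 0 then e else - e)"
    have d: "A *v d = \<mu> *\<^sub>R d" "d \<noteq> 0" "\<And>i. i \<in> {1..m} \<Longrightarrow> b i \<bullet> d = 0" "c \<bullet> d \<le> 0"
      using e by (auto simp: d_def Ker_def matrix_vector_mult_diff_rdistrib
          linear_neg[OF matrix_vector_mul_linear] simp flip: scaleR_matrix_vector_assoc)
    have "(norm (x - x0))\<^sup>2 \<le> \<alpha>"
      using x(1) by (simp add: g0_def)
    then obtain t where t: "t \<ge> 0" "(norm (x - x0 + t *\<^sub>R d))\<^sup>2 = \<alpha>"
      using ray_meets_sphere[OF d(2)] by blast
    define y where "y = x + t *\<^sub>R d"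
    have g0y: "g0 y = 0"
      using t(2) by (simp add: g0_def y_def algebra_simps)
    have "g i y \<le> 0" if "i \<in> {1..m}" for i
      using x(2)[OF that] d(3)[OF that] by (simp add: g_def y_def inner_simps)
    then have "0 \<le> h y"
      using f[of y] g0y by (simp add: h_def)
    also have "h y = h x + t * (c \<bullet> d)"
      using symmetric_inner[OF assms(1), of d x] d(1)
      by (simp add: h_def \<nu>\<mu> f_def g0_def y_def c_def power2_norm_eq_inner inner_simps
          matrix_vector_right_distrib matrix_vector_mult_scaleR inner_commute algebra_simps)
    also have "\<dots> \<le> h x"
      using t(1) d(4) by (simp add: mult_nonneg_nonpos)
    finally show ?thesis .
  qed

  have fwd: "\<exists>l :: nat \<Rightarrow> real. (\<forall>i\<in>{0..m}. l i \<ge> 0) \<and>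
        (\<forall>x. f x + l 0 * g0 x + (\<Sum>i=1..m. l i * g i x) + \<epsilon> \<ge> 0)"
    if f: "\<And>x. g0 x \<le> 0 \<Longrightarrow> (\<And>i. i \<in> {1..m} \<Longrightarrow> g i x \<le> 0) \<Longrightarrow> f x \<ge> 0"
      and \<epsilon>: "\<epsilon> > 0" for \<epsilon>
  proof -
    \<comment> \<open>Two rounds of duality: first the linear constraints over the compact ball,
      then the ball constraint over the whole space, where its sublevel sets are compact. Adding
      \<open>\<epsilon>\<close> turns \<open>h \<ge> 0\<close> into the strict positivity both
      rounds require.\<close>
    have conv_h\<epsilon>: "convex_on UNIV (\<lambda>x. h x + \<epsilon>)"
      by (intro convex_on_add conv_h) (simp add: convex_on_const)
    let ?K = "{x. g0 x \<le> 0}"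
    have "convex ?K"
      using convex_sublevel[OF conv_g0, of 0] by simp
    have "\<exists>l. (\<forall>i\<in>{1..m}. l i \<ge> 0) \<and> (\<forall>x\<in>?K. (h x + \<epsilon>) + (\<Sum>i=1..m. l i * g i x) > 0)"
    proof (rule convex_multipliers_compact)
      show "convex_on ?K (\<lambda>x. h x + \<epsilon>)" "\<And>i. convex_on ?K (g i)"
        using conv_h\<epsilon> conv_g by (auto intro: convex_on_subset[OF _ subset_UNIV \<open>convex ?K\<close>])
      show "h x + \<epsilon> > 0" if "x \<in> ?K" "\<And>i. i \<in> {1..m} \<Longrightarrow> g i x \<le> 0" for x
        using h_nonneg[OF f, of x] that \<epsilon> by force
    qed (use comp cont z in \<open>auto intro!: continuous_intros\<close>)
    then obtain l where l: "\<And>i. i \<in> {1..m} \<Longrightarrow> l i \<ge> 0"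
      "\<And>x. g0 x \<le> 0 \<Longrightarrow> (h x + \<epsilon>) + (\<Sum>i=1..m. l i * g i x) > 0"
      by blast
    define H where "H x = (h x + \<epsilon>) + (\<Sum>i=1..m. l i * g i x)" for x
    have "convex_on UNIV H"
      unfolding H_def using l(1) by (intro convex_on_nonneg_combination conv_h\<epsilon> conv_g) auto
    moreover have "continuous_on UNIV H"
      unfolding H_def by (intro continuous_intros cont)
    ultimately obtain k where k: "k \<ge> 0" "\<And>x. H x + k * g0 x > 0"
      using convex_multiplier_single[of UNIV H g0 z] conv_g0 cont comp z(1) l(2)
      by (auto simp: H_def)
    \<comment> \<open>\<open>H\<close> already contains \<open>- \<nu> * g0\<close>, so the ball
      multiplier for \<open>f\<close> is \<open>k - \<nu>\<close>. Index 0 is free because the sum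
      starts at 1.\<close>
    define l' where "l' = l(0 := k - \<nu>)"
    have eq: "(\<Sum>i=1..m. l' i * g i x) = (\<Sum>i=1..m. l i * g i x)" for x
      by (intro sum.cong) (auto simp: l'_def)
    have "f x + l' 0 * g0 x + (\<Sum>i=1..m. l' i * g i x) + \<epsilon> \<ge> 0" for x
      using k(2)[of x] unfolding eq by (simp add: l'_def H_def h_def algebra_simps)
    moreover have "\<forall>i\<in>{0..m}. l' i \<ge> 0"
      using l(1) k(1) \<nu> by (auto simp: l'_def)
    ultimately show ?thesis
      by blast
  qed

  have bwd: "f x \<ge> 0"
    if mult: "\<And>\<epsilon>. \<epsilon> > 0 \<Longrightarrow> \<exists>l :: nat \<Rightarrow> real. (\<forall>i\<in>{0..m}. l i \<ge> 0) \<and>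
        (\<forall>x. f x + l 0 * g0 x + (\<Sum>i=1..m. l i * g i x) + \<epsilon> \<ge> 0)"
      and x: "g0 x \<le> 0" "\<And>i. i \<in> {1..m} \<Longrightarrow> g i x \<le> 0" for x
  \<comment> \<open>At a feasible point every multiplier term is nonpositive, so
    \<open>f x \<ge> - \<epsilon>\<close> for each \<open>\<epsilon> > 0\<close>, although the
    multipliers may change with \<open>\<epsilon>\<close>.\<close>
  proof (rule field_le_epsilon)
    fix \<epsilon> :: real
    assume "\<epsilon> > 0"
    then obtain l :: "nat \<Rightarrow> real" where l: "\<forall>i\<in>{0..m}. l i \<ge> 0"
      "f x + l 0 * g0 x + (\<Sum>i=1..m. l i * g i x) + \<epsilon> \<ge> 0"
      using mult by blast
    have "l 0 * g0 x \<le> 0"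
      using l(1) x(1) by (simp add: mult_nonneg_nonpos)
    moreover have "(\<Sum>i=1..m. l i * g i x) \<le> 0"
      using l(1) x(2) by (intro sum_nonpos mult_nonneg_nonpos) auto
    ultimately show "0 \<le> f x + \<epsilon>"
      using l(2) by linarith
  qed

  show ?thesis
    unfolding f_def[symmetric] g0_def[symmetric] g_def[symmetric]
    using fwd bwd by blast
qed

end
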